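(* Let $\Gamma$ be a nonempty finite set, let $A\subseteq\Gamma$ be non-trivial (i.e. $A\neq\emptyset$ and $A\neq\Gamma$), and let $\mathcal B\subseteq\mathcal P(\Gamma)$ be a non-empty family of sets. Then $\rho(A,\mathcal B)=D^\circ_\cap(A\mid\mathcal B)$.
   Context: Cover complexity: let $U=\Gamma\setminus A$. A semi-filter over $U$ is a nonempty family $\mathcal F\subseteq\mathcal P(U)$ with $\emptyset\notin\mathcal F$ such that $U_1\in\mathcal F$ and $U_1\subseteq U_2\subseteq U$ imply $U_2\in\mathcal F$. $\mathcal F$ is above $w\in\Gamma$ (w.r.t. $\mathcal B$ and $U$) if for every $B\in\mathcal B$ with $w\in B$ we have $B\cap U\in\mathcal F$. $\mathcal F$ preserves a pair $(E,H)$ of subsets of $U$ if $E,H\in\mathcal F$ imply $E\cap H\in\mathcal F$; it preserves a collection $\Lambda$ if it preserves each pair. $\rho(A,\mathcal B)$ is the minimum size of a collection $\Lambda$ of pairs of subsets of $U$ such that no semi-filter over $U$ that preserves $\Lambda$ is above some $a\in A$ ($\infty$ if none exists). Cyclic intersection complexity: a syntactic sequence is a list of formal symbols $I_1,\dots,I_t$ together with, for each $i\in[t]$, an operation $I_i=K_{i_1}\star_iK_{i_2}$ with $K_{i_1},K_{i_2}\in\{I_1,\dots,I_t\}\cup\mathcal B$ and $\star_i\in\{\cap,\cup\}$ (no ordering requirement, so cycles are allowed). It is evaluated by setting $I_i^0=\emptyset$ for all $i$ and, for $j>0$, $I_i^j=I_i^{j-1}\cup(K_{i_1}^{j-1}\star_iK_{i_2}^{j-1})$,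 where each generator $B\in\mathcal B$ has value $B$ at every stage. It generates $A$ from $\mathcal B$ if there is $j_0$ with $I_t^{j}=A$ for all $j\ge j_0$. $D^\circ_\cap(A\mid\mathcal B)$ is the minimum number of indices $i$ with $\star_i=\cap$ over all syntactic sequences generating $A$ from $\mathcal B$ ($\infty$ if none). *)

theory Defs
  imports Main "HOL-Library.Extended_Nat"
begin

section \<open>Cover complexity\<close>

definition semi_filter :: "'a set \<Rightarrow> 'a set set \<Rightarrow> bool" where
  "semi_filter U F \<longleftrightarrow>
     F \<noteq> {} \<and> F \<subseteq> Pow U \<and> {} \<notin> F \<and>
     (\<forall>U1 U2. U1 \<in> F \<and> U1 \<subseteq> U2 \<and> U2 \<subseteq> U \<longrightarrow> U2 \<in> F)"

definition above :: "'a set set \<Rightarrow> 'a set \<Rightarrow> 'a set set \<Rightarrow> 'a \<Rightarrow> bool" where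
  "above \<B> U F w \<longleftrightarrow> (\<forall>B\<in>\<B>. w \<in> B \<longrightarrow> B \<inter> U \<in> F)"

definition preserves_pair :: "'a set set \<Rightarrow> 'a set \<times> 'a set \<Rightarrow> bool" where
  "preserves_pair F p \<longleftrightarrow> (fst p \<in> F \<and> snd p \<in> F \<longrightarrow> fst p \<inter> snd p \<in> F)"

definition preserves :: "'a set set \<Rightarrow> ('a set \<times> 'a set) set \<Rightarrow> bool" where
  "preserves F \<Lambda> \<longleftrightarrow> (\<forall>p\<in>\<Lambda>. preserves_pair F p)"

definition covering :: "'a set \<Rightarrow> 'a set \<Rightarrow> 'a set set \<Rightarrow> ('a set \<times> 'a set) set \<Rightarrow> bool" where
  "covering \<Gamma> A \<B> \<Lambda> \<longleftrightarrow>
     finite \<Lambda> \<and> \<Lambda> \<subseteq> Pow (\<Gamma> - A) \<times> Pow (\<Gamma> - A) \<and>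
     \<not> (\<exists>F. semi_filter (\<Gamma> - A) F \<and> preserves F \<Lambda> \<and> (\<exists>a\<in>A. above \<B> (\<Gamma> - A) F a))"

text \<open>An infimum in \<open>enat\<close> is a minimum when the set is nonempty, and \<open>\<infinity>\<close> otherwise.\<close>

definition cover_complexity :: "'a set \<Rightarrow> 'a set \<Rightarrow> 'a set set \<Rightarrow> enat" where
  "cover_complexity \<Gamma> A \<B> = (INF \<Lambda> \<in> {\<Lambda>. covering \<Gamma> A \<B> \<Lambda>}. enat (card \<Lambda>))"

section \<open>Cyclic intersection complexity\<close>

text \<open>The formal symbols \<open>I\<^sub>1, \<dots>, I\<^sub>t\<close> are numbered from \<open>0\<close>: the \<open>i\<close>-th entry
  (\<open>i < length s\<close>) of a syntactic sequence \<open>s\<close> is the operation attached to \<open>Sym i\<close>,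
  and the output symbol is \<open>Sym (length s - 1)\<close>.\<close>

datatype 'a operand = Gen "'a set" | Sym nat

datatype set_op = Cap | Cup

datatype 'a operation = Operation (oper: set_op) (lhs: "'a operand") (rhs: "'a operand")

definition operands :: "'a set set \<Rightarrow> nat \<Rightarrow> 'a operand set" where
  "operands \<B> t = Gen ` \<B> \<union> Sym ` {..<t}"

definition syntactic_sequence :: "'a set set \<Rightarrow> 'a operation list \<Rightarrow> bool" where
  "syntactic_sequence \<B> s \<longleftrightarrow>
     s \<noteq> [] \<and>
     (\<forall>c\<in>set s. lhs c \<in> operands \<B> (length s) \<and> rhs c \<in> operands \<B> (length s))"

primrec apply_op :: "set_op \<Rightarrow> 'a set \<Rightarrow> 'a set \<Rightarrow> 'a set" where
  "apply_op Cap X Y = X \<inter> Y"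
| "apply_op Cup X Y = X \<union> Y"

primrec operand_value :: "(nat \<Rightarrow> 'a set) \<Rightarrow> 'a operand \<Rightarrow> 'a set" where
  "operand_value v (Gen B) = B"
| "operand_value v (Sym i) = v i"

text \<open>\<open>stage s j i\<close> is the value of the symbol \<open>Sym i\<close> after \<open>j\<close> rounds; it is meaningful
  only for \<open>i < length s\<close>.\<close>

primrec stage :: "'a operation list \<Rightarrow> nat \<Rightarrow> nat \<Rightarrow> 'a set" where
  "stage s 0 = (\<lambda>i. {})"
| "stage s (Suc j) = (\<lambda>i. stage s j i \<union>
     apply_op (oper (s ! i))
       (operand_value (stage s j) (lhs (s ! i)))
       (operand_value (stage s j) (rhs (s ! i))))"

definition generates :: "'a set set \<Rightarrow> 'a operation list \<Rightarrow> 'a set \<Rightarrow> bool" where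
  "generates \<B> s A \<longleftrightarrow>
     syntactic_sequence \<B> s \<and> (\<exists>j0. \<forall>j\<ge>j0. stage s j (length s - 1) = A)"

definition num_intersections :: "'a operation list \<Rightarrow> nat" where
  "num_intersections s = card {i. i < length s \<and> oper (s ! i) = Cap}"

definition cyclic_intersection_complexity :: "'a set \<Rightarrow> 'a set set \<Rightarrow> enat" where
  "cyclic_intersection_complexity A \<B> =
     (INF s \<in> {s. generates \<B> s A}. enat (num_intersections s))"

end

theory Submission
  imports Defs
begin

text \<open>
  The value of a symbol in the limit is the least solution of the inclusions given by the
  operations. If a semi-filter is above \<open>a\<close> and preserves the pairs of limits (restricted to
  \<open>U = \<Gamma> - A\<close>) of the operands of the intersections, then it contains the limit of every symbol
  that receives \<open>a\<close>; applied to the output, whose limit misses \<open>U\<close>, this puts the empty set in it.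

  Conversely, the least upward closed family that is above \<open>w\<close> and preserves \<open>\<Lambda>\<close> can be computed
  for all \<open>w\<close> at once by a cyclic sequence with one intersection \<open>L \<inter> R\<close> per pair \<open>(E, H)\<close>:
  \<open>L\<close> and \<open>R\<close> collect the \<open>w\<close> for which \<open>E\<close>, respectively \<open>H\<close>, is in the family. The
  output collects the \<open>w\<close> for which the empty set is in the family. All of \<open>A\<close> is collected
  because \<open>\<Lambda>\<close> covers, and nothing else, since for \<open>w \<in> U\<close> the principal filter at \<open>w\<close> is
  above \<open>w\<close>.
\<close>

section \<open>Limits of cyclic sequences\<close>

definition limit :: "'a operation list \<Rightarrow> nat \<Rightarrow> 'a set" where
  "limit s i = (\<Union>j. stage s j i)"

lemma stage_mono: "j \<le> j' \<Longrightarrow> stage s j i \<subseteq> stage s j' i"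
  by (rule lift_Suc_mono_le[of "\<lambda>j. stage s j i"]) auto

lemma operand_value_mono: "(\<And>i. v i \<subseteq> w i) \<Longrightarrow> operand_value v x \<subseteq> operand_value w x"
  by (cases x) auto

lemma operand_value_mono_operands:
  assumes "x \<in> operands \<B> t" "\<And>i. i < t \<Longrightarrow> v i \<subseteq> w i"
  shows "operand_value v x \<subseteq> operand_value w x"
  using assms by (cases x) (auto simp: operands_def)

lemma operand_value_limit: "operand_value (limit s) x = (\<Union>j. operand_value (stage s j) x)"
  by (cases x) (auto simp: limit_def)

lemma apply_op_mono: "X \<subseteq> X' \<Longrightarrow> Y \<subseteq> Y' \<Longrightarrow> apply_op p X Y \<subseteq> apply_op p X' Y'"
  by (cases p) auto

text \<open>An element of an intersection may enter the two operands at different stages. Since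
  stages only grow, both operands contain it at the later one.\<close>

lemma limit_closed:
  "apply_op (oper (s ! i)) (operand_value (limit s) (lhs (s ! i)))
     (operand_value (limit s) (rhs (s ! i))) \<subseteq> limit s i"
proof
  fix w
  let ?l = "\<lambda>j. operand_value (stage s j) (lhs (s ! i))"
  let ?r = "\<lambda>j. operand_value (stage s j) (rhs (s ! i))"
  assume "w \<in> apply_op (oper (s ! i)) (operand_value (limit s) (lhs (s ! i)))
     (operand_value (limit s) (rhs (s ! i)))"
  then obtain j j' where "w \<in> apply_op (oper (s ! i)) (?l j) (?r j')"
    by (cases "oper (s ! i)") (auto simp: operand_value_limit)
  moreover have "?l j \<subseteq> ?l (max j j')" "?r j' \<subseteq> ?r (max j j')"
    by (auto intro!: operand_value_mono stage_mono)
  ultimately have "w \<in> apply_op (oper (s ! i)) (?l (max j j')) (?r (max j j'))"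
    using apply_op_mono by blast
  then have "w \<in> stage s (Suc (max j j')) i" by simp
  then show "w \<in> limit s i" unfolding limit_def by blast
qed

text \<open>Induction on the stage keeps every value inside \<open>W\<close>. Operands name only
  symbols below \<open>length s\<close>, so it suffices that \<open>W\<close> is closed
  there.\<close>

lemma limit_least:
  assumes syn: "syntactic_sequence \<B> s"
    and closed: "\<And>i. i < length s \<Longrightarrow>
      apply_op (oper (s ! i)) (operand_value W (lhs (s ! i))) (operand_value W (rhs (s ! i))) \<subseteq> W i"
    and "i < length s"
  shows "limit s i \<subseteq> W i"
proof -
  have "stage s j i \<subseteq> W i" if "i < length s" for i j
    using that
  proof (induction j arbitrary: i)
    case (Suc j)
    have "lhs (s ! i) \<in> operands \<B> (length s)" "rhs (s ! i) \<in> operands \<B> (length s)"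
      using syn Suc.prems by (auto simp: syntactic_sequence_def)
    moreover have "operand_value (stage s j) x \<subseteq> operand_value W x"
      if "x \<in> operands \<B> (length s)" for x
      using that Suc.IH by (rule operand_value_mono_operands)
    ultimately have "operand_value (stage s j) (lhs (s ! i)) \<subseteq> operand_value W (lhs (s ! i))"
      "operand_value (stage s j) (rhs (s ! i)) \<subseteq> operand_value W (rhs (s ! i))"
      by auto
    then have "apply_op (oper (s ! i)) (operand_value (stage s j) (lhs (s ! i)))
        (operand_value (stage s j) (rhs (s ! i))) \<subseteq> W i"
      using closed[OF Suc.prems] apply_op_mono by (meson subset_trans)
    then show ?case using Suc by simp
  qed simp
  then show ?thesis using assms(3) by (auto simp: limit_def)
qed

lemma generates_limit: "generates \<B> s A \<Longrightarrow> limit s (length s - 1) = A"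
proof -
  assume "generates \<B> s A"
  then obtain j0 where j0: "\<forall>j\<ge>j0. stage s j (length s - 1) = A"
    by (auto simp: generates_def)
  have "stage s j (length s - 1) \<subseteq> A" for j
  proof -
    have "stage s j (length s - 1) \<subseteq> stage s (max j j0) (length s - 1)"
      by (rule stage_mono) simp
    also have "\<dots> = A" using j0 by simp
    finally show ?thesis .
  qed
  moreover have "A = stage s j0 (length s - 1)" using j0 by simp
  ultimately show ?thesis unfolding limit_def by blast
qed

lemma generates_if_limit:
  assumes "syntactic_sequence \<B> s" "limit s (length s - 1) = A" "finite A"
  shows "generates \<B> s A"
proof -
  let ?o = "length s - 1"
  have "\<forall>a\<in>A. \<exists>j. a \<in> stage s j ?o" using assms(2) unfolding limit_def by blast
  then obtain f where f: "\<forall>a\<in>A. a \<in> stage s (f a) ?o" by metis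
  \<comment> \<open>Each of the finitely many elements of \<open>A\<close> has entered by stage
    \<open>f a\<close>. The inserted \<open>0\<close> keeps the maximum meaningful for empty
    \<open>A\<close>.\<close>
  have "stage s j ?o = A" if "j \<ge> Max (insert 0 (f ` A))" for j
  proof
    show "stage s j ?o \<subseteq> A" using assms(2) unfolding limit_def by blast
    show "A \<subseteq> stage s j ?o"
    proof
      fix a assume "a \<in> A"
      then have "f a \<le> j" using that assms(3) by simp
      then show "a \<in> stage s j ?o" using f \<open>a \<in> A\<close> stage_mono[of "f a" j s ?o] by blast
    qed
  qed
  then show ?thesis using assms(1) by (auto simp only: generates_def)
qed

section \<open>From a cyclic sequence to a covering collection\<close>

lemma limit_in_semi_filter:
  assumes syn: "syntactic_sequence \<B> s" and sf: "semi_filter U F" and ab: "above \<B> U F a"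
    and pres: "\<And>i. i < length s \<Longrightarrow> oper (s ! i) = Cap \<Longrightarrow>
      preserves_pair F (operand_value (limit s) (lhs (s ! i)) \<inter> U,
        operand_value (limit s) (rhs (s ! i)) \<inter> U)"
    and "i < length s" "a \<in> limit s i"
  shows "limit s i \<inter> U \<in> F"
proof -
  \<comment> \<open>\<open>?W i\<close> is everything if the limit of symbol \<open>i\<close>, cut
    down to \<open>U\<close>, lies in \<open>F\<close>, and everything but \<open>a\<close>
    otherwise. Inclusion in \<open>?W\<close> is thus the desired implication at \<open>a\<close>,
    and leastness of the limit replaces an induction along the possibly cyclic sequence.\<close>
  let ?W = "\<lambda>i. {w. w = a \<longrightarrow> limit s i \<inter> U \<in> F}"
  have up: "Y \<inter> U \<in> F" if "X \<in> F" "X \<subseteq> Y" for X Y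
    using sf that unfolding semi_filter_def
    by (meson Int_lower2 PowD le_infI subsetD)
  have val: "operand_value (limit s) x \<inter> U \<in> F"
    if "x \<in> operands \<B> (length s)" "a \<in> operand_value ?W x" for x
    using that ab by (cases x) (auto simp: operands_def above_def)
  have "limit s i \<subseteq> ?W i"
  proof (rule limit_least[OF syn])
    fix i assume i: "i < length s"
    let ?l = "lhs (s ! i)" and ?r = "rhs (s ! i)"
    have ops: "?l \<in> operands \<B> (length s)" "?r \<in> operands \<B> (length s)"
      using syn i by (auto simp: syntactic_sequence_def)
    have "limit s i \<inter> U \<in> F"
      if "a \<in> apply_op (oper (s ! i)) (operand_value ?W ?l) (operand_value ?W ?r)"
    proof (cases "oper (s ! i)")
      case Cap
      then have "(operand_value (limit s) ?l \<inter> U) \<inter> (operand_value (limit s) ?r \<inter> U) \<in> F"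
        using that val ops pres[OF i Cap] by (auto simp: preserves_pair_def)
      then show ?thesis using limit_closed[of s i] Cap by (auto elim: up)
    next
      case Cup
      then show ?thesis using that val[OF ops(1)] val[OF ops(2)] limit_closed[of s i]
        by (auto elim!: up)
    qed
    then show "apply_op (oper (s ! i)) (operand_value ?W ?l) (operand_value ?W ?r) \<subseteq> ?W i"
      by auto
  qed fact
  then show ?thesis using assms(6) by auto
qed

lemma covering_of_generates:
  assumes gen: "generates \<B> s A"
  obtains \<Lambda> where "covering \<Gamma> A \<B> \<Lambda>" "card \<Lambda> \<le> num_intersections s"
proof
  let ?U = "\<Gamma> - A"
  let ?I = "{i. i < length s \<and> oper (s ! i) = Cap}"
  let ?p = "\<lambda>i. (operand_value (limit s) (lhs (s ! i)) \<inter> ?U,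
    operand_value (limit s) (rhs (s ! i)) \<inter> ?U)"
  have syn: "syntactic_sequence \<B> s" using gen by (simp add: generates_def)
  have False if F: "semi_filter ?U F" "preserves F (?p ` ?I)" "a \<in> A" "above \<B> ?U F a" for F a
  proof -
    have "limit s (length s - 1) \<inter> ?U \<in> F"
    proof (rule limit_in_semi_filter[OF syn F(1,4)])
      show "length s - 1 < length s" using syn by (simp add: syntactic_sequence_def)
      show "a \<in> limit s (length s - 1)" using generates_limit[OF gen] F(3) by simp
    qed (use F(2) in \<open>simp add: preserves_def\<close>)
    then show False using generates_limit[OF gen] F(1) by (auto simp: semi_filter_def)
  qed
  then show "covering \<Gamma> A \<B> (?p ` ?I)" unfolding covering_def by auto
  \<comment> \<open>Different intersections may yield the same pair, hence only an
    inequality.\<close>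
  show "card (?p ` ?I) \<le> num_intersections s"
    unfolding num_intersections_def by (rule card_image_le) simp
qed

section \<open>From a covering collection to a cyclic sequence\<close>

text \<open>With \<open>k\<close> pairs \<open>P\<close> and \<open>m\<close> sources \<open>C\<close> (the generators and the intersections
  themselves), the symbols \<open>0, \<dots>, k - 1\<close> are the intersections and symbol \<open>k + c * m + r\<close> is the
  union of those of the first \<open>r + 1\<close> sources whose associated set lies in the \<open>c\<close>-th target;
  a target is a component of a pair or, at the end, the empty set. A missing operand of
  a union is replaced by the symbol itself, which has no effect on the limit.\<close>

definition targets :: "('a set \<times> 'a set) list \<Rightarrow> 'a set list" where
  "targets P = map fst P @ map snd P @ [{}]"

definition sources :: "'a set list \<Rightarrow> nat \<Rightarrow> 'a operand list" where
  "sources Bs k = map Gen Bs @ map Sym [0..<k]"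

text \<open>The set that belongs to the family of \<open>w\<close> once the source receives
  \<open>w\<close>: for a generator because the family is above \<open>w\<close>, for intersection
  \<open>j\<close> because the \<open>j\<close>-th pair is preserved.\<close>

primrec source_set :: "'a set \<Rightarrow> ('a set \<times> 'a set) list \<Rightarrow> 'a operand \<Rightarrow> 'a set" where
  "source_set U P (Gen B) = B \<inter> U"
| "source_set U P (Sym j) = fst (P ! j) \<inter> snd (P ! j)"

definition chain_op ::
    "'a set \<Rightarrow> ('a set \<times> 'a set) list \<Rightarrow> 'a operand list \<Rightarrow> nat \<Rightarrow> 'a operation" where
  "chain_op U P C i =
     (let c = (i - length P) div length C; r = (i - length P) mod length C
      in Operation Cup (Sym (if r = 0 then i else i - 1))
           (if source_set U P (C ! r) \<subseteq> targets P ! c then C ! r else Sym i))"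

definition chain_end :: "nat \<Rightarrow> nat \<Rightarrow> nat \<Rightarrow> nat" where
  "chain_end k m c = k + c * m + (m - 1)"

definition cover_sequence ::
    "'a set \<Rightarrow> ('a set \<times> 'a set) list \<Rightarrow> 'a operand list \<Rightarrow> 'a operation list" where
  "cover_sequence U P C =
     (let k = length P; m = length C in
      map (\<lambda>i. if i < k then Operation Cap (Sym (chain_end k m i)) (Sym (chain_end k m (k + i)))
               else chain_op U P C i) [0..<k + (2 * k + 1) * m])"

lemma targets_nth [simp]:
  "i < length P \<Longrightarrow> targets P ! i = fst (P ! i)"
  "i < length P \<Longrightarrow> targets P ! (length P + i) = snd (P ! i)"
  "targets P ! (2 * length P) = {}"
  by (auto simp: targets_def nth_append)

lemma length_cover_sequence [simp]:
  "length (cover_sequence U P C) = length P + (2 * length P + 1) * length C"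
  by (simp add: cover_sequence_def Let_def)

lemma cover_sequence_gate:
  "i < length P \<Longrightarrow> cover_sequence U P C ! i = Operation Cap
     (Sym (chain_end (length P) (length C) i)) (Sym (chain_end (length P) (length C) (length P + i)))"
  by (simp add: cover_sequence_def Let_def)

lemma cover_sequence_chain:
  "length P \<le> i \<Longrightarrow> i < length P + (2 * length P + 1) * length C \<Longrightarrow>
     cover_sequence U P C ! i = chain_op U P C i"
  by (simp add: cover_sequence_def Let_def)

lemma chain_index_less:
  fixes c k m r :: nat
  assumes "c \<le> 2 * k" "r < m"
  shows "k + c * m + r < k + (2 * k + 1) * m"
proof -
  have "c * m \<le> 2 * k * m" using assms(1) by simp
  then have "c * m + r < 2 * k * m + m" using assms(2) by linarith
  then show ?thesis by (simp add: algebra_simps)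
qed

lemma chain_end_less: "c \<le> 2 * k \<Longrightarrow> 0 < m \<Longrightarrow> chain_end k m c < k + (2 * k + 1) * m"
  unfolding chain_end_def by (rule chain_index_less) auto

lemma num_intersections_cover_sequence: "num_intersections (cover_sequence U P C) = length P"
proof -
  have "{i. i < length (cover_sequence U P C) \<and> oper (cover_sequence U P C ! i) = Cap}
      = {..<length P}" (is "?I = _")
  proof (intro set_eqI)
    fix i
    show "i \<in> ?I \<longleftrightarrow> i \<in> {..<length P}"
      by (cases "i < length P")
        (auto simp: cover_sequence_gate cover_sequence_chain chain_op_def Let_def)
  qed
  then show ?thesis by (simp add: num_intersections_def)
qed

lemma syntactic_cover_sequence:
  assumes "C \<noteq> []" "set C \<subseteq> operands \<B> (length P)"
  shows "syntactic_sequence \<B> (cover_sequence U P C)"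
proof -
  let ?s = "cover_sequence U P C"
  have C: "C ! r \<in> operands \<B> (length ?s)" if "r < length C" for r
  proof -
    have "operands \<B> (length P) \<subseteq> operands \<B> (length ?s)"
      unfolding operands_def by (intro Un_mono image_mono) auto
    then show ?thesis using assms(2) nth_mem[OF that] by blast
  qed
  have "lhs (?s ! i) \<in> operands \<B> (length ?s) \<and> rhs (?s ! i) \<in> operands \<B> (length ?s)"
    if i: "i < length ?s" for i
  proof (cases "i < length P")
    case True
    then show ?thesis using assms(1) chain_end_less[of _ "length P" "length C"]
      by (simp add: cover_sequence_gate operands_def)
  next
    case False
    have "(i - length P) mod length C < length C" using assms(1) by simp
    note C[OF this]
    moreover have "Sym i \<in> operands \<B> (length ?s)" "Sym (i - 1) \<in> operands \<B> (length ?s)"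
      using i by (auto simp: operands_def)
    moreover have "?s ! i = chain_op U P C i" using False i by (simp add: cover_sequence_chain)
    ultimately show ?thesis by (simp add: chain_op_def Let_def)
  qed
  moreover have "0 < length ?s" using assms(1) by simp
  then have "?s \<noteq> []" by force
  ultimately show ?thesis
    unfolding syntactic_sequence_def by (metis in_set_conv_nth)
qed

lemma limit_cover_sequence_subset:
  assumes C: "C \<noteq> []" "set C \<subseteq> operands \<B> (length P)" and "\<B> \<subseteq> Pow \<Gamma>"
  shows "limit (cover_sequence (\<Gamma> - A) P C) (chain_end (length P) (length C) (2 * length P)) \<subseteq> A"
proof -
  let ?k = "length P" and ?m = "length C"
  let ?s = "cover_sequence (\<Gamma> - A) P C"
  \<comment> \<open>The bound given by principal filters: outside \<open>A\<close>, a symbol may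
    collect \<open>w\<close> only if \<open>w\<close> lies in the set it stands for, namely the
    intersection of its pair or the target of its chain. For the last target \<open>{}\<close> only
    \<open>A\<close> remains.\<close>
  define W where "W i = A \<union>
    (if i < ?k then fst (P ! i) \<inter> snd (P ! i) else targets P ! ((i - ?k) div ?m))" for i
  have m: "0 < ?m" using C by simp
  have W_gate: "W i = A \<union> fst (P ! i) \<inter> snd (P ! i)" if "i < ?k" for i
    using that by (simp add: W_def)
  have W_chain: "W (?k + n) = A \<union> targets P ! (n div ?m)" for n
    by (simp add: W_def)
  have W_end: "W (chain_end ?k ?m c) = A \<union> targets P ! c" for c
    using m by (simp add: chain_end_def W_chain add.assoc)
  have W_source: "operand_value W x \<subseteq> A \<union> source_set (\<Gamma> - A) P x" if "x \<in> set C" for x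
  proof -
    have "x \<in> operands \<B> ?k" using that C(2) by blast
    then show ?thesis using assms(3) by (cases x) (auto simp: operands_def W_gate)
  qed
  have "limit ?s (chain_end ?k ?m (2 * ?k)) \<subseteq> W (chain_end ?k ?m (2 * ?k))"
  proof (rule limit_least[OF syntactic_cover_sequence[OF C]])
    show "chain_end ?k ?m (2 * ?k) < length ?s" using chain_end_less[of "2 * ?k" ?k ?m] m by simp
    fix i assume i: "i < length ?s"
    show "apply_op (oper (?s ! i)) (operand_value W (lhs (?s ! i)))
        (operand_value W (rhs (?s ! i))) \<subseteq> W i"
    proof (cases "i < ?k")
      case True
      then show ?thesis by (auto simp: cover_sequence_gate W_end W_gate)
    next
      case False
      define n where "n = i - ?k"
      have n: "i = ?k + n" using False by (simp add: n_def)
      \<comment> \<open>Away from the start of a chain, the preceding symbol lies in the same chain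
        and so has the same bound.\<close>
      have "W (i - 1) = W i" if "n mod ?m \<noteq> 0"
      proof -
        have "0 < n" using that by (cases n) auto
        then have "(n - 1) div ?m = n div ?m"
          using that by (cases n) (auto simp: div_Suc mod_Suc split: if_splits)
        moreover have "i - 1 = ?k + (n - 1)" using \<open>0 < n\<close> n by simp
        ultimately show ?thesis by (metis W_chain n)
      qed
      moreover have "operand_value W (C ! (n mod ?m)) \<subseteq> W i"
        if "source_set (\<Gamma> - A) P (C ! (n mod ?m)) \<subseteq> targets P ! (n div ?m)"
      proof -
        have "C ! (n mod ?m) \<in> set C" using m by simp
        from W_source[OF this] that show ?thesis unfolding n W_chain by blast
      qed
      moreover have "?s ! i = chain_op (\<Gamma> - A) P C i"
        using i False by (simp add: cover_sequence_chain)
      ultimately show ?thesis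
        by (simp add: chain_op_def Let_def flip: n_def)
    qed
  qed
  then show ?thesis unfolding W_end by simp
qed

text \<open>The source joins the \<open>c\<close>-th chain at its own position in \<open>C\<close>,
  and every later link contains its predecessor.\<close>

lemma source_subset_limit_chain_end:
  assumes x: "x \<in> set C" and sub: "source_set U P x \<subseteq> targets P ! c" and c: "c \<le> 2 * length P"
  shows "operand_value (limit (cover_sequence U P C)) x
    \<subseteq> limit (cover_sequence U P C) (chain_end (length P) (length C) c)"
proof -
  let ?k = "length P" and ?m = "length C"
  let ?s = "cover_sequence U P C"
  let ?L = "\<lambda>r. limit ?s (?k + c * ?m + r)"
  have op: "?s ! (?k + c * ?m + r) = chain_op U P C (?k + c * ?m + r)" if "r < ?m" for r
    using chain_index_less[OF c that] by (simp add: cover_sequence_chain)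
  have div: "(c * ?m + r) div ?m = c" if "r < ?m" for r
    using that by (subst div_mult_self3) auto
  have step: "?L r \<subseteq> ?L (Suc r)" if "Suc r < ?m" for r
    using limit_closed[of ?s "?k + c * ?m + Suc r"] op[OF that] that
    by (simp add: chain_op_def Let_def)
  obtain r where r: "r < ?m" "C ! r = x" using x by (metis in_set_conv_nth)
  have "operand_value (limit ?s) x \<subseteq> ?L r"
    using limit_closed[of ?s "?k + c * ?m + r"] op[OF r(1)] r sub div[OF r(1)]
    by (simp add: chain_op_def Let_def)
  also have "?L r \<subseteq> ?L (?m - 1)"
  proof -
    have "r' < ?m \<longrightarrow> ?L r \<subseteq> ?L r'" if "r \<le> r'" for r'
      using that by (induction r' rule: dec_induct) (use step in \<open>auto simp: Suc_lessD\<close>)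
    from this[of "?m - 1"] show ?thesis using r(1) by linarith
  qed
  finally show ?thesis by (simp add: chain_end_def)
qed

lemma limit_cover_sequence_superset:
  assumes cov: "covering \<Gamma> A \<B> (set P)" and "A \<subset> \<Gamma>"
    and C: "set C = Gen ` \<B> \<union> Sym ` {..<length P}"
  shows "A \<subseteq> limit (cover_sequence (\<Gamma> - A) P C) (chain_end (length P) (length C) (2 * length P))"
proof (rule ccontr)
  let ?U = "\<Gamma> - A" and ?k = "length P" and ?m = "length C"
  let ?s = "cover_sequence ?U P C"
  assume "\<not> ?thesis"
  then obtain a where a: "a \<in> A" "a \<notin> limit ?s (chain_end ?k ?m (2 * ?k))" by blast
  \<comment> \<open>The upward closure, within \<open>?U\<close>, of the sets of those sources that
    receive \<open>a\<close>. Enlarged by \<open>?U\<close>, it will be a semi-filter that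
    contradicts the covering.\<close>
  define G where "G = {X. X \<subseteq> ?U \<and>
    (\<exists>x\<in>set C. a \<in> operand_value (limit ?s) x \<and> source_set ?U P x \<subseteq> X)}"
  have collected: "a \<in> limit ?s (chain_end ?k ?m c)" if "targets P ! c \<in> G" "c \<le> 2 * ?k" for c
    using that source_subset_limit_chain_end[of _ C ?U P c] by (auto simp: G_def)
  have P_U: "fst (P ! i) \<subseteq> ?U" "snd (P ! i) \<subseteq> ?U" if "i < ?k" for i
  proof -
    have "P ! i \<in> Pow ?U \<times> Pow ?U"
      using cov nth_mem[OF that] unfolding covering_def by blast
    then show "fst (P ! i) \<subseteq> ?U" "snd (P ! i) \<subseteq> ?U" by (auto simp: mem_Times_iff)
  qed
  have G_pair: "fst (P ! i) \<inter> snd (P ! i) \<in> G"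
    if "i < ?k" "fst (P ! i) \<in> G" "snd (P ! i) \<in> G" for i
  proof -
    \<comment> \<open>If both components are in \<open>G\<close>, then \<open>a\<close> reaches both
      operands of intersection \<open>i\<close>. This intersection is itself a source, so its
      associated set enters \<open>G\<close>.\<close>
    have "a \<in> limit ?s (chain_end ?k ?m i)" "a \<in> limit ?s (chain_end ?k ?m (?k + i))"
      using collected[of i] collected[of "?k + i"] that by auto
    then have "a \<in> limit ?s i"
      using limit_closed[of ?s i] that(1) by (auto simp: cover_sequence_gate)
    moreover have "Sym i \<in> set C" using C that(1) by simp
    ultimately show ?thesis unfolding G_def using P_U(1)[OF that(1)]
      by (auto intro: bexI[of _ "Sym i"])
  qed
  \<comment> \<open>Adding \<open>?U\<close> only matters if no generator contains \<open>a\<close>, when \<open>G\<close> may be empty.\<close>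
  let ?F = "insert ?U G"
  have "semi_filter ?U ?F"
  proof -
    \<comment> \<open>The empty set is the target with index \<open>2 * ?k\<close>, and
      \<open>a\<close> is missing from the end of its chain.\<close>
    have "{} \<notin> G" using collected[of "2 * ?k"] a(2) by auto
    then show ?thesis using assms(2) unfolding semi_filter_def G_def by blast
  qed
  moreover have "preserves ?F (set P)"
  proof -
    \<comment> \<open>If one component is \<open>?U\<close>, the intersection is just the other
      component, which lies in \<open>?F\<close> already.\<close>
    have "preserves_pair ?F (P ! i)" if "i < ?k" for i
      using P_U[OF that] G_pair[OF that]
      by (auto simp: preserves_pair_def Int_absorb1 Int_absorb2)
    then show ?thesis unfolding preserves_def by (metis in_set_conv_nth)
  qed
  moreover have "above \<B> ?U ?F a"
    unfolding above_def
  proof (intro ballI impI)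
    fix B assume "B \<in> \<B>" "a \<in> B"
    then have "Gen B \<in> set C" "a \<in> operand_value (limit ?s) (Gen B)" using C by auto
    then show "B \<inter> ?U \<in> ?F" unfolding G_def by fastforce
  qed
  ultimately show False using cov a(1) unfolding covering_def by blast
qed

lemma generates_of_covering:
  assumes "finite \<Gamma>" "A \<subset> \<Gamma>" "\<B> \<subseteq> Pow \<Gamma>" "\<B> \<noteq> {}" and cov: "covering \<Gamma> A \<B> \<Lambda>"
  obtains s where "generates \<B> s A" "num_intersections s = card \<Lambda>"
proof -
  \<comment> \<open>A listing without repetitions makes the number of intersections exactly
    \<open>card \<Lambda>\<close>.\<close>
  obtain P where P: "set P = \<Lambda>" "distinct P"
    using cov finite_distinct_list[of \<Lambda>] unfolding covering_def by metis
  have "finite \<B>" using assms(3) by (rule finite_subset) (simp add: assms(1))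
  then obtain Bs where Bs: "set Bs = \<B>" using finite_list by blast
  define C where "C = sources Bs (length P)"
  have C: "set C = Gen ` \<B> \<union> Sym ` {..<length P}"
    by (auto simp: C_def sources_def Bs)
  have C_ne: "C \<noteq> []" using C assms(4) by auto
  have C_op: "set C \<subseteq> operands \<B> (length P)" using C by (simp add: operands_def)
  let ?s = "cover_sequence (\<Gamma> - A) P C"
  have "0 < length C" using C_ne by simp
  \<comment> \<open>The chain of the target \<open>{}\<close> comes last, so its end is the output
    symbol.\<close>
  then have out: "length ?s - 1 = chain_end (length P) (length C) (2 * length P)"
    unfolding chain_end_def length_cover_sequence add_mult_distrib by linarith
  have "limit ?s (length ?s - 1) = A"
    unfolding out
  proof (rule antisym)
    show "limit ?s (chain_end (length P) (length C) (2 * length P)) \<subseteq> A"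
      by (rule limit_cover_sequence_subset[OF C_ne C_op assms(3)])
    show "A \<subseteq> limit ?s (chain_end (length P) (length C) (2 * length P))"
      using limit_cover_sequence_superset[OF _ assms(2) C] cov P(1) by simp
  qed
  then have "generates \<B> ?s A"
    by (rule generates_if_limit[OF syntactic_cover_sequence[OF C_ne C_op]])
      (use finite_subset[of A \<Gamma>] assms(1,2) in auto)
  moreover have "num_intersections ?s = card \<Lambda>"
    using distinct_card[OF P(2)] P(1) by (simp add: num_intersections_cover_sequence)
  ultimately show thesis by (rule that)
qed

theorem theorem1p3:
  fixes \<Gamma> A :: "'a set" and \<B> :: "'a set set"
  assumes "finite \<Gamma>" and "\<Gamma> \<noteq> {}"
    and "A \<subseteq> \<Gamma>" and "A \<noteq> {}" and "A \<noteq> \<Gamma>"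
    and "\<B> \<subseteq> Pow \<Gamma>" and "\<B> \<noteq> {}"
  shows "cover_complexity \<Gamma> A \<B> = cyclic_intersection_complexity A \<B>"
proof (rule antisym)
  show "cover_complexity \<Gamma> A \<B> \<le> cyclic_intersection_complexity A \<B>"
    unfolding cover_complexity_def cyclic_intersection_complexity_def
  \<comment> \<open>Comparing the infima witness by witness also covers the value
    \<open>\<infinity>\<close>, where no witness exists.\<close>
  proof (rule INF_mono)
    fix s assume "s \<in> {s. generates \<B> s A}"
    then obtain \<Lambda> where "covering \<Gamma> A \<B> \<Lambda>" "card \<Lambda> \<le> num_intersections s"
      using covering_of_generates by blast
    then show "\<exists>\<Lambda>\<in>{\<Lambda>. covering \<Gamma> A \<B> \<Lambda>}. enat (card \<Lambda>) \<le> enat (num_intersections s)"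
      by auto
  qed
  show "cyclic_intersection_complexity A \<B> \<le> cover_complexity \<Gamma> A \<B>"
    unfolding cover_complexity_def cyclic_intersection_complexity_def
  proof (rule INF_mono)
    fix \<Lambda> assume "\<Lambda> \<in> {\<Lambda>. covering \<Gamma> A \<B> \<Lambda>}"
    then obtain s where "generates \<B> s A" "num_intersections s = card \<Lambda>"
      using generates_of_covering[of \<Gamma> A \<B> \<Lambda>] assms by blast
    then show "\<exists>s\<in>{s. generates \<B> s A}. enat (num_intersections s) \<le> enat (card \<Lambda>)"
      by (metis mem_Collect_eq order_refl)
  qed
qed

end
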